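(* Let $k \geq 3$ be an integer. There exists a unique strictly decreasing sequence $(a_i)_{i=1}^{\infty}$ of positive real numbers with $a_1 = 1$ such that \[ G = \bigcup_{i=1}^{\infty} (a_{2i}, a_{2i-1}] \] is a $k$-good set, and \[ \operatorname{Bad}(G) = \bigcup_{i=1}^{\infty} (a_{2i+1}, a_{2i}]. \]
   Context: Here $(u,v] = \{x \in \mathbf{R} : u < x \leq v\}$, and $k \geq 3$ is a fixed integer. A geometric progression of length $k$ with integer ratio is a sequence $(a, ar, ar^2, \ldots, ar^{k-1})$ with $a$ a positive real number and $r \geq 2$ an integer. A set of positive real numbers is $k$-good if it contains no geometric progression of length $k$ with integer ratio. For a $k$-good set $G \subseteq (0,1]$, a number $x \in (0,1] \setminus G$ is $k$-bad with respect to $G$ if there exists an integer $r \geq 2$ such that $G \cup \{x\}$ contains $x, xr, xr^2, \ldots, xr^{k-1}$ (equivalently, $xr^j \in G$ for all $j \in \{1, \ldots, k-1\}$). Define $\operatorname{Bad}(G) = \{x \in (0,1] \setminus G : x \text{ is } k\text{-bad with respect to } G\}$. *)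

theory Defs
  imports "HOL-Analysis.Analysis"
begin

(* The term set; since a > 0 and r >= 2 wherever it is used, the terms are strictly
   increasing, so containing the progression means containing this set. *)
definition int_ratio_gp :: "nat \<Rightarrow> real \<Rightarrow> nat \<Rightarrow> real set" where
  "int_ratio_gp k a r = (\<lambda>j. a * real r ^ j) ` {..<k}"

definition k_good :: "nat \<Rightarrow> real set \<Rightarrow> bool" where
  "k_good k G \<longleftrightarrow> G \<subseteq> {0<..} \<and> \<not> (\<exists>a r. 0 < a \<and> 2 \<le> r \<and> int_ratio_gp k a r \<subseteq> G)"

definition k_bad :: "nat \<Rightarrow> real set \<Rightarrow> real \<Rightarrow> bool" where
  "k_bad k G x \<longleftrightarrow> (\<exists>r\<ge>2. int_ratio_gp k x r \<subseteq> G \<union> {x})"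

definition Bad :: "nat \<Rightarrow> real set \<Rightarrow> real set" where
  "Bad k G = {x \<in> {0<..1} - G. k_bad k G x}"

(* Sequences (a_i), i >= 1, are modelled as functions on nat with a_i given by a (i - 1), so
   that they carry no irrelevant value at 0 (which would spoil uniqueness). The two unions
   below are thus the unions over i >= 1 of (a_{2i}, a_{2i-1}] and of (a_{2i+1}, a_{2i}]. *)
definition odd_blocks :: "(nat \<Rightarrow> real) \<Rightarrow> real set" where
  "odd_blocks a = (\<Union>i. {a (2 * i + 1)<..a (2 * i)})"

definition even_blocks :: "(nat \<Rightarrow> real) \<Rightarrow> real set" where
  "even_blocks a = (\<Union>i. {a (2 * i + 2)<..a (2 * i + 1)})"

end

theory Submission
  imports Defs
begin

text \<open>
  Whether \<open>x\<close> is bad depends only on which numbers from \<open>2 * x\<close> upwards lie in the set, so there is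
  exactly one way to run through \<open>(0, 1]\<close> downwards and sort every number into a good set or its
  bad points: the recursion that defines \<open>greedy\<close>. A sequence as in the theorem is one whose
  blocks are, in turn, inside and outside this greedy set, and everything comes down to showing
  that the greedy set has such a block structure.

  Near a fixed \<open>x > 0\<close> only finitely many ratios matter, since \<open>x * r > 1\<close> for large \<open>r\<close>. Hence
  membership near \<open>x\<close> is a finite Boolean combination of memberships near the points
  \<open>x * r ^ j\<close>, and by induction it is constant on some \<open>(d, x]\<close> (\<open>greedy_left_stable\<close>) and on some
  \<open>(x, d)\<close> (\<open>greedy_right_stable\<close>). On the other hand it is not constant near \<open>0\<close>
  (\<open>greedy_both_below\<close>): the greedy set cannot contain an interval \<open>(0, e)\<close>, which contains
  progressions, and it cannot miss one, because very small numbers are then too far away from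
  the remaining members to be bad. This is where \<open>k \<ge> 3\<close> enters.

  For existence, start at \<open>1\<close> and pass repeatedly to the largest smaller number of the opposite
  kind. It exists because membership changes again further down, and it is attained by
  stability on the left. The sequence tends to \<open>0\<close>, since at a positive limit stability on the
  right would fail (\<open>alternating_sequence_exists\<close>). So its blocks exhaust \<open>(0, 1]\<close>.

  For uniqueness, a competing sequence might have a positive limit. But above any of its terms
  the blocks cover everything up to \<open>1\<close>, so there they coincide with the greedy set (\<open>greedy_unique\<close>). Two sequences with the same start whose blocks alternate between
  a set and its complement are equal (\<open>alternates_unique\<close>).
\<close>

section \<open>Good sets in terms of badness\<close>

text \<open>
  As \<open>x\<close> is positive, the later terms of a progression from \<open>x\<close> differ from \<open>x\<close>, so adjoining \<open>x\<close>
  to \<open>G\<close> only supplies the initial term.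
\<close>

lemma k_bad_iff:
  assumes "0 < x"
  shows "k_bad k G x \<longleftrightarrow> (\<exists>r\<ge>2. \<forall>j\<in>{1..<k}. x * real r ^ j \<in> G)"
proof -
  have "int_ratio_gp k x r \<subseteq> G \<union> {x} \<longleftrightarrow> (\<forall>j\<in>{1..<k}. x * real r ^ j \<in> G)"
    if r: "2 \<le> r" for r
  proof -
    have "x * real r ^ j \<noteq> x" if "1 \<le> j" for j
      using assms r that one_less_power[of "real r" j] by (simp add: less_imp_neq[symmetric])
    moreover have "{..<k} \<subseteq> insert 0 {1..<k}"
      by auto
    ultimately show ?thesis
      unfolding int_ratio_gp_def by fastforce
  qed
  then show ?thesis
    unfolding k_bad_def by blast
qed

lemma k_good_iff_no_bad:
  assumes "0 < k"
  shows "k_good k G \<longleftrightarrow> G \<subseteq> {0<..} \<and> (\<forall>x\<in>G. \<not> k_bad k G x)"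
proof -
  have "int_ratio_gp k x r \<subseteq> G \<longleftrightarrow> x \<in> G \<and> int_ratio_gp k x r \<subseteq> G \<union> {x}" for x r
    using assms unfolding int_ratio_gp_def by force
  then show ?thesis
    unfolding k_good_def k_bad_def by (metis greaterThan_iff subsetD)
qed

section \<open>The greedy set\<close>

text \<open>
  The termination proof must see the bounds on \<open>x\<close> while it treats the recursive calls.
\<close>

declare conj_cong [fundef_cong]

text \<open>
  The range conditions sit inside the recursion so that it stops above \<open>1\<close>. Each call at least
  doubles the argument and thus halves \<open>1 / x\<close>, which is at least \<open>1\<close>.
\<close>

function greedy :: "nat \<Rightarrow> real \<Rightarrow> bool" where
  "greedy k x \<longleftrightarrow> 0 < x \<and> x \<le> 1 \<and>
     (\<forall>r. 2 \<le> r \<longrightarrow> (\<exists>j\<in>{1..<k}. \<not> greedy k (x * real r ^ j)))"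
  by auto
termination
proof (relation "Wellfounded.measure (\<lambda>(k, x). nat \<lfloor>1 / x\<rfloor>)", goal_cases)
  case (2 k x r j)
  have "real r ^ 1 \<le> real r ^ j"
    using 2 by (intro power_increasing) auto
  then have "2 \<le> real r ^ j"
    using 2 by (simp add: order_trans[of 2 "real r"])
  then have "x * 2 \<le> x * real r ^ j"
    using 2 by (intro mult_left_mono) auto
  then have "1 / (x * real r ^ j) \<le> 1 / (x * 2)"
    using 2 by (intro divide_left_mono) auto
  moreover have "1 / (x * 2) = (1 / x) / 2" "1 \<le> 1 / x"
    using 2 by (auto simp: field_simps)
  moreover have "\<lfloor>u\<rfloor> < \<lfloor>t\<rfloor> \<and> 0 < \<lfloor>t\<rfloor>" if "u \<le> t / 2" "1 \<le> t" for t u :: real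
  proof -
    have "1 \<le> \<lfloor>t\<rfloor>"
      using that by simp
    then show ?thesis
      using that by linarith
  qed
  ultimately have "\<lfloor>1 / (x * real r ^ j)\<rfloor> < \<lfloor>1 / x\<rfloor> \<and> 0 < \<lfloor>1 / x\<rfloor>"
    by metis
  then show ?case
    by simp
qed auto

text \<open>As a rewrite rule the defining equation would unfold forever.\<close>

declare greedy.simps [simp del]

lemma greedy_imp_bounds: "greedy k x \<Longrightarrow> 0 < x \<and> x \<le> 1"
  by (subst (asm) greedy.simps) auto

lemma greedy_iff_not_bad:
  assumes "0 < x" "x \<le> 1"
  shows "greedy k x \<longleftrightarrow> \<not> k_bad k (Collect (greedy k)) x"
  using assms by (subst greedy.simps) (auto simp: k_bad_iff)

lemma k_good_greedy:
  assumes "0 < k"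
  shows "k_good k (Collect (greedy k))"
  using greedy_imp_bounds greedy_iff_not_bad by (auto simp: k_good_iff_no_bad[OF assms])

lemma Bad_greedy: "Bad k (Collect (greedy k)) = {0<..1} - Collect (greedy k)"
  using greedy_iff_not_bad by (auto simp: Bad_def)

text \<open>
  If a good set and its bad points leave no gap in \<open>[x, 1]\<close>, then on this interval membership
  satisfies the recursion of \<open>greedy\<close>: members are not bad, because the set is good, and
  non-members are bad. The covering is asked for on \<open>[x, 1]\<close> only, so that the lemma applies to a
  sequence whose limit is not yet known to be \<open>0\<close>.
\<close>

lemma greedy_unique:
  assumes "k_good k G" "G \<subseteq> {0<..1}" "0 < k"
    and "0 < x" "{x..1} \<subseteq> G \<union> Bad k G"
  shows "x \<in> G \<longleftrightarrow> greedy k x"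
  using assms
proof (induction k x rule: greedy.induct)
  case (1 k x)
  show ?case
  proof (cases "x \<le> 1")
    case False
    then show ?thesis
      using 1 greedy_imp_bounds by fastforce
  next
    case True
    have IH: "x * real r ^ j \<in> G \<longleftrightarrow> greedy k (x * real r ^ j)"
      if "2 \<le> r" "j \<in> {1..<k}" for r j
    proof -
      have "x \<le> x * real r ^ j"
        using that 1 by (simp add: mult_le_cancel_left1)
      then have "{x * real r ^ j..1} \<subseteq> {x..1}"
        by simp
      then have "{x * real r ^ j..1} \<subseteq> G \<union> Bad k G" "0 < x * real r ^ j"
        using "1.prems"(4,5) that by (blast, simp)
      then show ?thesis
        using 1 that True by (intro "1.IH") simp_all
    qed
    have "x \<in> G \<longleftrightarrow> \<not> k_bad k G x"
      using 1 True by (auto simp: k_good_iff_no_bad Bad_def)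
    also have "\<dots> \<longleftrightarrow> greedy k x"
      using IH 1 True by (subst greedy.simps) (auto simp: k_bad_iff)
    finally show ?thesis .
  qed
qed

section \<open>One-sided stability\<close>

text \<open>
  Around \<open>x\<close>, ratios above \<open>2 / x\<close> already push the second term of the progression beyond \<open>1\<close>. One
  finite set of ratios thus serves a whole neighbourhood of \<open>x\<close>, which allows a passage to the
  filters below.
\<close>

lemma greedy_near:
  assumes "0 < x" "2 \<le> k"
  obtains N where "\<And>y. x / 2 < y \<Longrightarrow> greedy k y \<longleftrightarrow>
     y \<le> 1 \<and> (\<forall>r\<in>{2..N}. \<exists>j\<in>{1..<k}. \<not> greedy k (y * real r ^ j))"
proof -
  obtain N where N: "2 / x < real N"
    using reals_Archimedean2 by blast
  have "greedy k y \<longleftrightarrow>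
     y \<le> 1 \<and> (\<forall>r\<in>{2..N}. \<exists>j\<in>{1..<k}. \<not> greedy k (y * real r ^ j))"
    if y: "x / 2 < y" for y
  proof -
    have "\<exists>j\<in>{1..<k}. \<not> greedy k (y * real r ^ j)" if "N < r" for r
    proof
      have "1 = (x / 2) * (2 / x)"
        using assms by simp
      also have "\<dots> < y * real r"
        using y N that assms by (intro mult_strict_mono) auto
      finally show "\<not> greedy k (y * real r ^ 1)"
        using greedy_imp_bounds by fastforce
    qed (use assms in auto)
    then have "(\<forall>r. 2 \<le> r \<longrightarrow> (\<exists>j\<in>{1..<k}. \<not> greedy k (y * real r ^ j))) \<longleftrightarrow>
       (\<forall>r\<in>{2..N}. \<exists>j\<in>{1..<k}. \<not> greedy k (y * real r ^ j))"
      by (metis atLeastAtMost_iff not_le_imp_less)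
    then show ?thesis
      using y assms by (subst greedy.simps) auto
  qed
  then show ?thesis
    using that by blast
qed

lemma eventually_Ball_Bex_iff:
  assumes "finite R" "finite J"
    and "\<And>r j. r \<in> R \<Longrightarrow> j \<in> J \<Longrightarrow> \<forall>\<^sub>F y in F. Q r j y \<longleftrightarrow> q r j"
  shows "\<forall>\<^sub>F y in F. (\<forall>r\<in>R. \<exists>j\<in>J. \<not> Q r j y) \<longleftrightarrow> (\<forall>r\<in>R. \<exists>j\<in>J. \<not> q r j)"
proof -
  have "\<forall>\<^sub>F y in F. \<forall>r\<in>R. \<forall>j\<in>J. Q r j y \<longleftrightarrow> q r j"
    using assms by (intro eventually_ball_finite ballI) auto
  then show ?thesis
    by eventually_elim blast
qed

lemma filterlim_times_pos_at_left:
  fixes c :: real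
  assumes "0 < c"
  shows "filterlim (\<lambda>y. y * c) (at_left (x * c)) (at_left x)"
  unfolding filterlim_at
  using assms by (auto simp: eventually_at_filter intro!: tendsto_intros)

lemma filterlim_times_pos_at_right:
  fixes c :: real
  assumes "0 < c"
  shows "filterlim (\<lambda>y. y * c) (at_right (x * c)) (at_right x)"
  unfolding filterlim_at
  using assms by (auto simp: eventually_at_filter intro!: tendsto_intros)

text \<open>
  The recursion refers only to the points \<open>x * r ^ j\<close>. Multiplication by a positive constant
  respects one-sided neighbourhoods, so stability there is carried to \<open>x\<close>. On the left the value
  at \<open>x\<close> itself persists, because the condition \<open>y \<le> 1\<close> survives a decrease of \<open>y\<close>. On the right
  the value may change at once, as it does at \<open>x = 1\<close>, so only some constant can be claimed.
\<close>

lemma greedy_left_stable: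
  assumes "0 < x" "2 \<le> k"
  shows "\<forall>\<^sub>F y in at_left x. greedy k y \<longleftrightarrow> greedy k x"
  using assms
proof (induction k x rule: greedy.induct)
  case (1 k x)
  show ?case
  proof (cases "x \<le> 1")
    case False
    then have "\<forall>\<^sub>F y in at_left x. 1 < y"
      using eventually_at_left_real[of 1 x] by (auto elim: eventually_mono)
    then show ?thesis
      by eventually_elim (use False greedy_imp_bounds in fastforce)
  next
    case True
    obtain N where N: "\<And>y. x / 2 < y \<Longrightarrow> greedy k y \<longleftrightarrow>
       y \<le> 1 \<and> (\<forall>r\<in>{2..N}. \<exists>j\<in>{1..<k}. \<not> greedy k (y * real r ^ j))"
      using greedy_near 1 by metis
    have "\<forall>\<^sub>F y in at_left x. greedy k (y * real r ^ j) \<longleftrightarrow> greedy k (x * real r ^ j)"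
      if "r \<in> {2..N}" "j \<in> {1..<k}" for r j
    proof -
      have pos: "0 < real r ^ j"
        using that by simp
      then have "\<forall>\<^sub>F y in at_left (x * real r ^ j). greedy k y \<longleftrightarrow> greedy k (x * real r ^ j)"
        using 1 True that by (intro "1.IH") auto
      then show ?thesis
        by (rule eventually_compose_filterlim) (rule filterlim_times_pos_at_left[OF pos])
    qed
    then have "\<forall>\<^sub>F y in at_left x. (\<forall>r\<in>{2..N}. \<exists>j\<in>{1..<k}. \<not> greedy k (y * real r ^ j)) \<longleftrightarrow>
       (\<forall>r\<in>{2..N}. \<exists>j\<in>{1..<k}. \<not> greedy k (x * real r ^ j))"
      by (intro eventually_Ball_Bex_iff) auto
    moreover have "\<forall>\<^sub>F y in at_left x. y \<in> {x / 2<..<x}"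
      using 1 by (intro eventually_at_left_real) auto
    ultimately show ?thesis
      by eventually_elim (use N N[of x] 1 True in auto)
  qed
qed

lemma greedy_right_stable:
  assumes "0 < x" "2 \<le> k"
  shows "\<exists>b. \<forall>\<^sub>F y in at_right x. greedy k y \<longleftrightarrow> b"
  using assms
proof (induction k x rule: greedy.induct)
  case (1 k x)
  show ?case
  proof (cases "x < 1")
    case False
    have "\<forall>\<^sub>F y in at_right x. y \<in> {x<..<x + 1}"
      by (intro eventually_at_right_real) auto
    then have "\<forall>\<^sub>F y in at_right x. greedy k y \<longleftrightarrow> False"
      by eventually_elim (use False greedy_imp_bounds in fastforce)
    then show ?thesis ..
  next
    case True
    obtain N where N: "\<And>y. x / 2 < y \<Longrightarrow> greedy k y \<longleftrightarrow>
       y \<le> 1 \<and> (\<forall>r\<in>{2..N}. \<exists>j\<in>{1..<k}. \<not> greedy k (y * real r ^ j))"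
      using greedy_near 1 by metis
    have "\<exists>b. \<forall>\<^sub>F y in at_right x. greedy k (y * real r ^ j) \<longleftrightarrow> b"
      if "r \<in> {2..N}" "j \<in> {1..<k}" for r j
    proof -
      have pos: "0 < real r ^ j"
        using that by simp
      then have "\<exists>b. \<forall>\<^sub>F y in at_right (x * real r ^ j). greedy k y \<longleftrightarrow> b"
        using 1 True that by (intro "1.IH") auto
      then show ?thesis
        using eventually_compose_filterlim[OF _ filterlim_times_pos_at_right[OF pos, of x]]
        by blast
    qed
    then obtain b where "\<And>r j. r \<in> {2..N} \<Longrightarrow> j \<in> {1..<k} \<Longrightarrow>
        \<forall>\<^sub>F y in at_right x. greedy k (y * real r ^ j) \<longleftrightarrow> b r j"
      by metis
    then have "\<forall>\<^sub>F y in at_right x. (\<forall>r\<in>{2..N}. \<exists>j\<in>{1..<k}. \<not> greedy k (y * real r ^ j)) \<longleftrightarrow>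
       (\<forall>r\<in>{2..N}. \<exists>j\<in>{1..<k}. \<not> b r j)"
      by (intro eventually_Ball_Bex_iff) auto
    moreover have "\<forall>\<^sub>F y in at_right x. y \<in> {x<..<1}"
      using True by (intro eventually_at_right_real) auto
    ultimately have "\<forall>\<^sub>F y in at_right x. greedy k y \<longleftrightarrow>
       (\<forall>r\<in>{2..N}. \<exists>j\<in>{1..<k}. \<not> b r j)"
      by eventually_elim (use N 1 in auto)
    then show ?thesis ..
  qed
qed

section \<open>Non-constancy near zero\<close>

text \<open>
  If all small numbers were greedy, a progression of ratio \<open>2\<close> that starts low enough would be
  too. If none below \<open>d < 1\<close> were, take \<open>x = d\<^sup>2 / 2\<close>: being bad for some \<open>r\<close>, it has \<open>x * r \<ge> d\<close>
  and \<open>x * r\<^sup>2 \<le> 1\<close>, both terms occurring since \<open>k \<ge> 3\<close>. Then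
  \<open>d\<^sup>2 \<le> (x * r)\<^sup>2 = x * (x * r\<^sup>2) \<le> x\<close>, which is absurd.
\<close>

lemma greedy_both_below:
  assumes "3 \<le> k" "0 < e"
  shows "\<exists>y. 0 < y \<and> y < e \<and> (greedy k y \<longleftrightarrow> b)"
proof (rule ccontr)
  assume none: "\<nexists>y. 0 < y \<and> y < e \<and> (greedy k y \<longleftrightarrow> b)"
  \<comment> \<open>Halving makes \<open>d\<close> itself fall in the range where membership is constant.\<close>
  define d where "d = min e 1 / 2"
  have d: "0 < d" "d < e" "d < 1"
    using assms by (auto simp: d_def)
  show False
  proof (cases b)
    case False
    define x where "x = d / 2 ^ k"
    have "greedy k (x * real 2 ^ j)" if "j < k" for j
    proof -
      have "x * 2 ^ j \<le> x * 2 ^ k"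
        using that d by (intro mult_left_mono power_increasing) (auto simp: x_def)
      also have "\<dots> = d"
        by (simp add: x_def)
      finally show ?thesis
        using none False d by (auto simp: x_def)
    qed
    then have "greedy k x" "\<And>j. j \<in> {1..<k} \<Longrightarrow> greedy k (x * real 2 ^ j)"
      using assms by (force dest: spec[of _ 0])+
    then show False
      by (subst (asm) greedy.simps) auto
  next
    case True
    define x where "x = d ^ 2 / 2"
    have dd: "d ^ 2 < d"
      using d by (simp add: power2_eq_square)
    then have x: "0 < x" "x < d" "x \<le> 1"
      using d by (auto simp: x_def)
    then have "\<not> greedy k x"
      using none True d by auto
    then obtain r where r: "2 \<le> r" "\<And>j. j \<in> {1..<k} \<Longrightarrow> greedy k (x * real r ^ j)"
      using x by (subst (asm) greedy.simps) auto
    have g: "greedy k (x * real r)" "greedy k (x * real r ^ 2)"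
      using r(2)[of 1] r(2)[of 2] assms by auto
    have "d < x * real r"
      using g(1) none True d greedy_imp_bounds by fastforce
    then have "d * d < (x * real r) * (x * real r)"
      using d by (intro mult_strict_mono) auto
    also have "\<dots> = x * (x * real r ^ 2)"
      by (simp add: power2_eq_square)
    also have "\<dots> \<le> x * 1"
      using x greedy_imp_bounds[OF g(2)] by (intro mult_left_mono) auto
    finally show False
      using d by (simp add: x_def power2_eq_square)
  qed
qed

section \<open>Alternating sequences\<close>

definition alternates :: "(real \<Rightarrow> bool) \<Rightarrow> (nat \<Rightarrow> real) \<Rightarrow> bool" where
  "alternates P a \<longleftrightarrow> (\<forall>n x. a (Suc n) < x \<longrightarrow> x \<le> a n \<longrightarrow> (P x \<longleftrightarrow> even n))"

text \<open>
  At the first index where the sequences part, the larger of the two next terms lies in the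
  block that the other sequence has just opened, but also opens the following block of its own,
  which has the opposite parity.
\<close>

lemma alternates_unique:
  assumes "strict_antimono_on UNIV a" "strict_antimono_on UNIV b" "a 0 = b 0"
    and "alternates P a" "alternates P b"
  shows "a = b"
proof
  have *: "\<not> a' (Suc n) < b' (Suc n)"
    if "strict_antimono_on UNIV b'" "alternates P a'" "alternates P b'" "a' n = b' n"
    for a' b' :: "nat \<Rightarrow> real" and n
  proof
    assume less: "a' (Suc n) < b' (Suc n)"
    have dec: "b' (Suc n) < b' n" "b' (Suc (Suc n)) < b' (Suc n)"
      using that(1) by (auto simp: monotone_on_def)
    have "P (b' (Suc n)) \<longleftrightarrow> even n"
      using that less dec unfolding alternates_def by auto
    moreover have "P (b' (Suc n)) \<longleftrightarrow> even (Suc n)"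
      using that dec unfolding alternates_def by blast
    ultimately show False
      by simp
  qed
  show "a n = b n" for n
  proof (induction n)
    case (Suc n)
    then show ?case
      using *[of b a n] *[of a b n] assms by (metis linorder_neqE)
  qed (fact assms)
qed

lemma block_exists:
  fixes a :: "nat \<Rightarrow> real"
  assumes "a n < x" "x \<le> a 0"
  shows "\<exists>m. a (Suc m) < x \<and> x \<le> a m"
  using assms
proof (induction n)
  case (Suc n)
  then show ?case
    by (cases "a n < x") (auto simp: not_less)
qed simp

lemma mem_blocks_iff:
  "x \<in> odd_blocks a \<longleftrightarrow> (\<exists>n. even n \<and> a (Suc n) < x \<and> x \<le> a n)"
  "x \<in> even_blocks a \<longleftrightarrow> (\<exists>n. odd n \<and> a (Suc n) < x \<and> x \<le> a n)"
proof -
  show "x \<in> odd_blocks a \<longleftrightarrow> (\<exists>n. even n \<and> a (Suc n) < x \<and> x \<le> a n)"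
    by (simp add: odd_blocks_def) (metis dvd_triv_left evenE)
  show "x \<in> even_blocks a \<longleftrightarrow> (\<exists>n. odd n \<and> a (Suc n) < x \<and> x \<le> a n)"
    by (simp add: even_blocks_def) (metis Suc_eq_plus1 odd_two_times_div_two_succ oddE even_Suc dvd_triv_left)
qed

lemma blocks_Un:
  assumes "strict_antimono_on UNIV a"
  shows "x \<in> odd_blocks a \<union> even_blocks a \<longleftrightarrow> x \<le> a 0 \<and> (\<exists>n. a n < x)"
proof -
  have "a n \<le> a 0" for n
    using monotone_onD[OF assms, of 0 n] by (cases "n = 0") auto
  moreover have "x \<in> odd_blocks a \<union> even_blocks a \<longleftrightarrow> (\<exists>n. a (Suc n) < x \<and> x \<le> a n)"
    unfolding Un_iff mem_blocks_iff by blast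
  ultimately show ?thesis
    using block_exists[of a _ x] by (auto intro: order_trans)
qed

text \<open>
  The blocks cover \<open>[x, 1]\<close> for every \<open>x\<close> above some term, so \<open>greedy_unique\<close> identifies the odd
  blocks with the greedy set there. The even blocks are disjoint from the odd ones since bad
  points are by definition not in the set.
\<close>

lemma alternates_greedy_if_solution:
  assumes "0 < k" "strict_antimono_on UNIV a" "\<And>i. 0 < a i" "a 0 = 1"
    and "k_good k (odd_blocks a)" "Bad k (odd_blocks a) = even_blocks a"
  shows "alternates (greedy k) a"
  unfolding alternates_def
proof (intro allI impI)
  fix n x
  assume x: "a (Suc n) < x" "x \<le> a n"
  have union: "y \<in> odd_blocks a \<union> Bad k (odd_blocks a) \<longleftrightarrow> y \<le> 1 \<and> (\<exists>n. a n < y)" for y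
    using blocks_Un[OF assms(2)] assms(4,6) by simp
  have pos: "0 < x"
    using x assms(3)[of "Suc n"] by linarith
  have "0 < y \<and> y \<le> 1" if "y \<in> odd_blocks a" for y
    using that union[of y] assms(5) unfolding k_good_def by auto
  then have "odd_blocks a \<subseteq> {0<..1}"
    by auto
  moreover have "{x..1} \<subseteq> odd_blocks a \<union> Bad k (odd_blocks a)"
    using union x(1) by (meson atLeastAtMost_iff less_le_trans subsetI)
  ultimately have iff: "x \<in> odd_blocks a \<longleftrightarrow> greedy k x"
    using assms(1,5) pos by (intro greedy_unique)
  have "x \<in> even_blocks a \<Longrightarrow> x \<notin> odd_blocks a"
    using assms(6) by (auto simp: Bad_def)
  then show "greedy k x \<longleftrightarrow> even n"
    using iff x unfolding mem_blocks_iff by blast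
qed

text \<open>
  The next term is the supremum of the smaller numbers of the opposite kind. Were it of the same
  kind as the current term, stability to its left would keep the opposite kind away from it. So
  the supremum is a maximum, and everything strictly above it up to the current term is of the
  current kind: precisely a half-open block.
\<close>

lemma alternating_sequence_exists:
  fixes P :: "real \<Rightarrow> bool"
  assumes c: "0 < c" "P c"
    and left: "\<And>x. 0 < x \<Longrightarrow> \<forall>\<^sub>F y in at_left x. P y \<longleftrightarrow> P x"
    and right: "\<And>x. 0 < x \<Longrightarrow> \<exists>b. \<forall>\<^sub>F y in at_right x. P y \<longleftrightarrow> b"
    and both: "\<And>e b. 0 < e \<Longrightarrow> \<exists>y. 0 < y \<and> y < e \<and> (P y \<longleftrightarrow> b)"
  obtains a where "strict_antimono_on UNIV a" "\<And>i. 0 < a i" "a 0 = c"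
    "alternates P a" "a \<longlonglongrightarrow> 0"
proof -
  have step: "\<exists>y. (0 < y \<and> (P y \<longleftrightarrow> \<not> P x)) \<and> y < x \<and> (\<forall>z. y < z \<longrightarrow> z \<le> x \<longrightarrow> (P z \<longleftrightarrow> P x))"
    if x: "0 < x" for x
  proof -
    define A where "A = {y. 0 < y \<and> y < x \<and> (P y \<longleftrightarrow> \<not> P x)}"
    define s where "s = Sup A"
    obtain y where y: "y \<in> A"
      using both[OF x, of "\<not> P x"] by (auto simp: A_def)
    have bdd: "bdd_above A"
      by (rule bdd_aboveI[of _ x]) (auto simp: A_def)
    have "y \<le> s"
      using y bdd by (simp add: s_def cSup_upper)
    then have pos: "0 < s"
      using y by (auto simp: A_def)
    have le: "s \<le> x"
      unfolding s_def by (rule cSup_least) (use y in \<open>auto simp: A_def\<close>)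
    have same: "P z \<longleftrightarrow> P x" if "s < z" "z \<le> x" for z
      using that pos cSup_upper[OF _ bdd, of z] by (cases "z = x") (auto simp: A_def s_def)
    have flip: "P s \<longleftrightarrow> \<not> P x"
    proof (rule ccontr)
      assume no: "\<not> (P s \<longleftrightarrow> \<not> P x)"
      obtain d where d: "d < s" "\<And>z. d < z \<Longrightarrow> z < s \<Longrightarrow> P z \<longleftrightarrow> P s"
        using left[OF pos] by (auto simp: eventually_at_left_field)
      obtain z where "z \<in> A" "d < z"
        using less_cSupD[of A d] y d by (auto simp: s_def)
      moreover from this have "z \<le> s"
        using bdd by (simp add: s_def cSup_upper)
      ultimately show False
        using d(2)[of z] no by (cases "z = s") (auto simp: A_def)
    qed
    then have "s < x"
      using le by (cases "s = x") auto
    then show ?thesis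
      using pos flip same by blast
  qed
  \<comment> \<open>The clause for \<open>n = 0\<close> fixes the starting point of the dependent choice.\<close>
  have "\<exists>a. \<forall>n. (0 < a n \<and> (P (a n) \<longleftrightarrow> even n) \<and> (n = 0 \<longrightarrow> a n = c)) \<and>
      (a (Suc n) < a n \<and> (\<forall>z. a (Suc n) < z \<longrightarrow> z \<le> a n \<longrightarrow> (P z \<longleftrightarrow> P (a n))))"
  proof (rule dependent_nat_choice)
    show "\<exists>x. 0 < x \<and> (P x \<longleftrightarrow> even (0::nat)) \<and> (0 = (0::nat) \<longrightarrow> x = c)"
      using c by auto
  next
    fix x and n :: nat
    assume "0 < x \<and> (P x \<longleftrightarrow> even n) \<and> (n = 0 \<longrightarrow> x = c)"
    then show "\<exists>y. (0 < y \<and> (P y \<longleftrightarrow> even (Suc n)) \<and> (Suc n = 0 \<longrightarrow> y = c)) \<and>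
        y < x \<and> (\<forall>z. y < z \<longrightarrow> z \<le> x \<longrightarrow> (P z \<longleftrightarrow> P x))"
      using step[of x] by auto
  qed
  then obtain a where a: "\<And>n. 0 < a n" "\<And>n. P (a n) \<longleftrightarrow> even n" "a 0 = c"
      "\<And>n. a (Suc n) < a n" "\<And>n z. a (Suc n) < z \<Longrightarrow> z \<le> a n \<Longrightarrow> P z \<longleftrightarrow> P (a n)"
    by metis
  have anti: "strict_antimono_on UNIV a"
    using a(4) by (auto simp: monotone_on_def intro: lift_Suc_mono_less[of "\<lambda>n. - a n", simplified])
  have dec: "decseq a"
    using a(4) by (auto simp: decseq_Suc_iff less_imp_le)
  obtain l where l: "a \<longlonglongrightarrow> l" "\<And>n. l \<le> a n"
    using decseq_convergent[OF dec, of 0] a(1) by (metis less_imp_le)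
  have "l = 0"
  proof (rule ccontr)
    assume "l \<noteq> 0"
    moreover have "0 \<le> l"
      using l(1) a(1) by (intro LIMSEQ_le_const) (auto simp: less_imp_le)
    ultimately obtain b where "\<forall>\<^sub>F y in at_right l. P y \<longleftrightarrow> b"
      using right[of l] by auto
    then obtain d where d: "l < d" "\<And>y. l < y \<Longrightarrow> y < d \<Longrightarrow> P y \<longleftrightarrow> b"
      by (auto simp: eventually_at_right_field)
    obtain n where n: "a n < d"
      using order_tendstoD(2)[OF l(1) d(1)] by (auto simp: eventually_sequentially)
    have "l < a n" for n
      using l(2)[of "Suc n"] a(4)[of n] by linarith
    then have "P (a n) \<longleftrightarrow> P (a (Suc n))"
      using d(2) n a(4)[of n] by (meson order.strict_trans)
    then show False
      using a(2) by simp
  qed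
  then show ?thesis
    using that[of a] anti a l(1) by (auto simp: alternates_def)
qed

lemma alternates_imp_blocks:
  assumes "strict_antimono_on UNIV a" "alternates P a" "a \<longlonglongrightarrow> 0" "\<And>i. 0 < a i"
  shows "odd_blocks a = {x \<in> {0<..a 0}. P x}" "even_blocks a = {x \<in> {0<..a 0}. \<not> P x}"
proof -
  have un: "x \<in> odd_blocks a \<union> even_blocks a \<longleftrightarrow> x \<in> {0<..a 0}" for x
  proof -
    have "(\<exists>n. a n < x) \<longleftrightarrow> 0 < x"
      using order_tendstoD(2)[OF assms(3), of x] assms(4)
      by (auto simp: eventually_sequentially intro: less_trans)
    then show ?thesis
      using blocks_Un[OF assms(1)] by auto
  qed
  have "x \<in> odd_blocks a \<Longrightarrow> P x" "x \<in> even_blocks a \<Longrightarrow> \<not> P x" for x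
    using assms(2) by (auto simp: mem_blocks_iff alternates_def)
  then show "odd_blocks a = {x \<in> {0<..a 0}. P x}" "even_blocks a = {x \<in> {0<..a 0}. \<not> P x}"
    using un by blast+
qed

theorem theorem2:
  fixes k :: nat
  assumes "k \<ge> 3"
  shows "\<exists>!a :: nat \<Rightarrow> real.
    strict_antimono_on UNIV a \<and> (\<forall>i. 0 < a i) \<and> a 0 = 1 \<and>
    k_good k (odd_blocks a) \<and> Bad k (odd_blocks a) = even_blocks a"
proof (rule ex_ex1I)
  have one: "greedy k 1"
    using assms by (subst greedy.simps) (auto intro!: bexI[of _ 1] dest!: greedy_imp_bounds)
  obtain a where a: "strict_antimono_on UNIV a" "\<And>i. 0 < a i" "a 0 = 1"
      "alternates (greedy k) a" "a \<longlonglongrightarrow> 0"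
    by (rule alternating_sequence_exists[of 1 "greedy k"])
      (use one assms greedy_left_stable greedy_right_stable greedy_both_below in auto)
  have "odd_blocks a = Collect (greedy k)" "even_blocks a = {0<..1} - Collect (greedy k)"
    using alternates_imp_blocks[OF a(1,4,5,2)] a(3) greedy_imp_bounds by auto
  then show "\<exists>a. strict_antimono_on UNIV a \<and> (\<forall>i. 0 < a i) \<and> a 0 = 1 \<and>
      k_good k (odd_blocks a) \<and> Bad k (odd_blocks a) = even_blocks a"
    using a k_good_greedy[of k] Bad_greedy assms by (intro exI[of _ a]) auto
next
  fix a b :: "nat \<Rightarrow> real"
  assume "strict_antimono_on UNIV a \<and> (\<forall>i. 0 < a i) \<and> a 0 = 1 \<and>
      k_good k (odd_blocks a) \<and> Bad k (odd_blocks a) = even_blocks a"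
    and "strict_antimono_on UNIV b \<and> (\<forall>i. 0 < b i) \<and> b 0 = 1 \<and>
      k_good k (odd_blocks b) \<and> Bad k (odd_blocks b) = even_blocks b"
  then show "a = b"
    using assms alternates_greedy_if_solution[of k a] alternates_greedy_if_solution[of k b]
    by (intro alternates_unique[of a b "greedy k"]) auto
qed

end
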